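(* Let $q=p^n$ with $p$ prime, and let $d$ be a divisor of $q-1$ with $2\le d<q-1$. Let $S_d=\{x^d:x\in\mathbb{F}_q^*\}$. Write the base-$p$ expansion $\frac{q-1}{d}=\sum_{j=0}^{n}e_jp^j$ with $0\le e_j\le p-1$. Suppose that at least one of the following holds: (i) $\frac{q-1}{d}\le\frac{2p}{3}$; (ii) $e_j\le\frac{p-1}{2}$ for each $0\le j<n/2$; (iii) $n=2r+1$ with $r\ge1$, $d\le 2p-2$, and $e_r\le p-1-\lceil\sqrt p\rceil/2$; (iv) $n=2r$, $d\le 2p^2$, and $e_{r-1}\le\frac{p-3}{2}$. Then there is no set $A\subset\mathbb{F}_q$ with $A+A=S_d$.
   Context: $\mathbb{F}_q$ is the finite field with $q$ elements. $A+A=\{a+a':a,a'\in A\}$. (A pair $(d,q)$ satisfying one of (i)–(iv) is called "good" in the paper.) *)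

theory Defs
  imports Complex_Main "HOL-Computational_Algebra.Primes" "HOL-Library.Set_Algebras"
begin

end

theory Submission
  imports Defs "HOL-Computational_Algebra.Polynomial"
begin

text \<open>
  Hanson--Petridis polynomial method. Put \<open>m = (q - 1) / d\<close> and suppose \<open>A + A = S\<^sub>d\<close>, \<open>N = |A|\<close>.
  For \<open>B \<subseteq> A\<close> with \<open>y + 1\<close> elements choose weights \<open>c\<close> that annihilate the moments of order \<open>< y\<close> of \<open>B\<close>
  and give the \<open>y\<close>-th moment the value 1. Then \<open>\<Sum>b\<in>B. c b (X + b)\<^sup>y\<^sup>+\<^sup>m - 1\<close> vanishes to order
  \<open>y + 1\<close> at each point of \<open>A\<close>, because \<open>(a + b)\<^sup>m = 1\<close>, and it has degree \<open>m\<close>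
  as soon as \<open>p\<close> does not divide \<open>y + m choose m\<close>, that is,
  as soon as \<open>y + m\<close> can be added in base \<open>p\<close> without carry. Hence \<open>N (y + 1) \<le> m\<close> for all such \<open>y < N\<close>.
  On the other hand \<open>m = |A + A| \<le> N (N + 1) / 2\<close>, so that no such \<open>y\<close> exceeds \<open>(N - 1) / 2\<close>.
  Each of the four digit conditions provides a carry-free \<open>y\<close> that is too large.
\<close>

section \<open>Carries in base \<open>p\<close> and divisibility of binomial coefficients\<close>

lemma multiplicity_fact_add_less:
  fixes p a b :: nat
  assumes "prime p" "b < p"
  shows "multiplicity p (fact (p * a + b) :: nat) = multiplicity p (fact (p * a) :: nat)"
  using \<open>b < p\<close>
proof (induction b)
  case (Suc b)
  have "\<not> p dvd Suc (p * a + b)"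
    using Suc.prems by (metis add_Suc_right dvd_add_right_iff dvd_triv_left nat_dvd_not_less zero_less_Suc)
  then have "multiplicity p (Suc (p * a + b)) = 0"
    by (rule not_dvd_imp_multiplicity_0)
  moreover have "(fact (p * a + Suc b) :: nat) = Suc (p * a + b) * fact (p * a + b)"
    by simp
  ultimately show ?case
    using Suc assms by (simp add: prime_elem_multiplicity_mult_distrib del: fact_Suc mult_Suc)
qed simp

text \<open>Legendre's formula as a recursion: only the \<open>a\<close> multiples of
  \<open>p\<close> among the factors contribute, and dividing each of them by \<open>p\<close>
  leaves \<open>fact a\<close>.\<close>

lemma multiplicity_fact_mult_add:
  fixes p a b :: nat
  assumes "prime p" "b < p"
  shows "multiplicity p (fact (p * a + b) :: nat) = a + multiplicity p (fact a :: nat)"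
proof -
  have p0: "p > 0" using assms(1) by (simp add: prime_gt_0_nat)
  have "multiplicity p (fact (p * a) :: nat) = a + multiplicity p (fact a :: nat)"
  proof (induction a)
    case (Suc a)
    have "p * Suc a = Suc (p * a + (p - 1))"
      using p0 by simp
    then have "(fact (p * Suc a) :: nat) = p * (Suc a * fact (p * a + (p - 1)))"
      by (metis fact_Suc mult.assoc of_nat_id)
    then have "multiplicity p (fact (p * Suc a) :: nat) =
        1 + (multiplicity p (Suc a) + multiplicity p (fact (p * a + (p - 1)) :: nat))"
      using assms p0 by (simp add: prime_elem_multiplicity_mult_distrib multiplicity_prime del: fact_Suc mult_Suc)
    also have "multiplicity p (fact (p * a + (p - 1)) :: nat) = a + multiplicity p (fact a :: nat)"
      using multiplicity_fact_add_less[OF assms(1), of "p - 1" a] p0 Suc by simp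
    finally show ?case
      using assms by (simp add: prime_elem_multiplicity_mult_distrib del: mult_Suc)
  qed simp
  then show ?thesis
    using multiplicity_fact_add_less[OF assms] by simp
qed

text \<open>One step of Kummer's theorem: when the lowest digits add without carry, the terms
  \<open>a\<close>, \<open>c\<close> and \<open>a + c\<close> of the Legendre recursion cancel, so
  the quotients by \<open>p\<close> decide divisibility.\<close>

lemma prime_dvd_choose_digit:
  fixes p a b c d :: nat
  assumes "prime p" "b + d < p"
  shows "p dvd ((p * a + b) + (p * c + d) choose (p * c + d)) \<longleftrightarrow> p dvd (a + c choose c)"
proof -
  have mult_choose: "multiplicity p (fact k :: nat) + multiplicity p (fact l :: nat) +
      multiplicity p (l + k choose k) = multiplicity p (fact (l + k) :: nat)" for k l :: nat
  proof -
    have "(fact (l + k) :: nat) = fact k * fact l * (l + k choose k)"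
      using binomial_fact_lemma[of k "l + k"] by simp
    then show ?thesis
      using assms(1) by (simp add: prime_elem_multiplicity_mult_distrib)
  qed
  have "(p * a + b) + (p * c + d) = p * (a + c) + (b + d)"
    by (simp add: algebra_simps)
  then have "multiplicity p (fact ((p * a + b) + (p * c + d)) :: nat) = a + c + multiplicity p (fact (a + c) :: nat)"
    using multiplicity_fact_mult_add[OF assms, of "a + c"] by (simp only:)
  then have "multiplicity p ((p * a + b) + (p * c + d) choose (p * c + d)) = multiplicity p (a + c choose c)"
    using mult_choose[of "p * c + d" "p * a + b"] mult_choose[of c a]
      multiplicity_fact_mult_add[OF assms(1), of b a] multiplicity_fact_mult_add[OF assms(1), of d c] assms(2) by linarith
  moreover have "p dvd (k + l choose l) \<longleftrightarrow> multiplicity p (k + l choose l) \<noteq> 0" for k l :: nat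
    using assms(1) by (simp add: prime_elem_multiplicity_eq_zero_iff)
  ultimately show ?thesis
    by simp
qed

text \<open>All digits of \<open>t * p ^ r\<close> other than the one at position \<open>r\<close>
  are zero, so a carry could only start there, and the hypothesis forbids it.\<close>

lemma not_prime_dvd_choose_single_digit:
  fixes p m r t :: nat
  assumes "prime p" "t + m div p ^ r mod p < p"
  shows "\<not> p dvd (t * p ^ r + m choose m)"
  using assms(2)
proof (induction r arbitrary: m)
  case 0
  then show ?case
    using prime_dvd_choose_digit[OF assms(1), of t "m mod p" 0 "m div p"] assms(1) by auto
next
  case (Suc r)
  then have "\<not> p dvd (t * p ^ r + m div p choose (m div p))"
    by (simp add: div_mult2_eq)
  then show ?case
    using prime_dvd_choose_digit[OF assms(1), of 0 "m mod p" "t * p ^ r" "m div p"] assms(1)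
    by (simp add: prime_gt_0_nat ac_simps)
qed

text \<open>Each digit of \<open>y\<close> is the smaller of the digit of \<open>x\<close> and the
  room that \<open>m\<close> leaves below \<open>p\<close>. This room is at least half of
  \<open>p - 1\<close>, so at least half of every digit of \<open>x\<close> survives.\<close>

lemma no_carry_half:
  fixes p k m x :: nat
  assumes "prime p" "\<And>j. j < k \<Longrightarrow> 2 * (m div p ^ j mod p) < p" "x < p ^ k"
  shows "\<exists>y\<le>x. x \<le> 2 * y \<and> \<not> p dvd (y + m choose m)"
  using assms(2,3)
proof (induction k arbitrary: m x)
  case 0
  then show ?case using assms(1) by auto
next
  case (Suc k)
  have p0: "p > 0" using assms(1) by (simp add: prime_gt_0_nat)
  have "\<exists>y\<le>x div p. x div p \<le> 2 * y \<and> \<not> p dvd (y + m div p choose (m div p))"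
  proof (rule Suc.IH)
    show "2 * (m div p div p ^ j mod p) < p" if "j < k" for j
      using Suc.prems(1)[of "Suc j"] that by (simp add: div_mult2_eq)
    show "x div p < p ^ k"
      using Suc.prems(2) p0 by (simp add: less_mult_imp_div_less mult.commute)
  qed
  then obtain y where y: "y \<le> x div p" "x div p \<le> 2 * y" "\<not> p dvd (y + m div p choose (m div p))"
    by blast
  define g where "g = min (x mod p) (p - 1 - m mod p)"
  have m0: "2 * (m mod p) < p" using Suc.prems(1)[of 0] by simp
  have "g + m mod p < p" using m0 by (simp add: g_def)
  then have "\<not> p dvd (p * y + g + m choose m)"
    using prime_dvd_choose_digit[OF assms(1), of g "m mod p" y "m div p"] y(3) by simp
  moreover have "x mod p < p" using p0 by simp
  then have "g \<le> x mod p" "x mod p \<le> 2 * g" using m0 unfolding g_def by linarith+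
  moreover have "p * y \<le> p * (x div p)" "p * (x div p) \<le> 2 * (p * y)"
    using y(1,2) mult_le_mono2[of "x div p" "2 * y" p] by auto
  moreover have "x = p * (x div p) + x mod p" by simp
  ultimately have "p * y + g \<le> x" "x \<le> 2 * (p * y + g)"
    unfolding distrib_left by linarith+
  then show ?case
    using \<open>\<not> p dvd (p * y + g + m choose m)\<close> by blast
qed

text \<open>The bound \<open>x = 2 * y\<close> is exactly the case that the size estimates alone
  cannot refute when \<open>x + 1 = N\<close>. The lowest digit is treated separately so that
  equality survives only together with \<open>p dvd x + 1\<close>.\<close>

lemma no_carry_half_strict:
  fixes p k m x :: nat
  assumes "prime p" "odd p" "\<And>j. j < k \<Longrightarrow> 2 * (m div p ^ j mod p) < p" "0 < x" "x < p ^ k"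
  shows "\<exists>y\<le>x. x \<le> 2 * y \<and> (x < 2 * y \<or> p dvd x + 1) \<and> \<not> p dvd (y + m choose m)"
proof -
  have p3: "p \<ge> 3"
    using assms(1,2) prime_ge_2_nat[of p] by (cases "p = 2") auto
  from assms(4,5) obtain k' where k: "k = Suc k'"
    by (cases k) auto
  have "\<exists>y\<le>x div p. x div p \<le> 2 * y \<and> \<not> p dvd (y + m div p choose (m div p))"
  proof (rule no_carry_half[OF assms(1)])
    show "2 * (m div p div p ^ j mod p) < p" if "j < k'" for j
      using assms(3)[of "Suc j"] that k by (simp add: div_mult2_eq)
    show "x div p < p ^ k'"
      using assms(5) k p3 by (simp add: less_mult_imp_div_less mult.commute)
  qed
  then obtain y where y: "y \<le> x div p" "x div p \<le> 2 * y" "\<not> p dvd (y + m div p choose (m div p))"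
    by blast
  have m0: "2 * (m mod p) < p" using assms(3)[of 0] k by simp
  have xm: "x mod p < p" using p3 by simp
  have nc: "\<not> p dvd (p * y + g + m choose m)" if "g + m mod p < p" for g
    using prime_dvd_choose_digit[OF assms(1) that, of y "m div p"] y(3) by simp
  have py: "p * y \<le> p * (x div p)" "p * (x div p) \<le> 2 * (p * y)"
    using y(1,2) mult_le_mono2[of "x div p" "2 * y" p] by auto
  have xeq: "p * (x div p) + x mod p = x" by simp
  consider "x mod p = 0" "y = x div p" | "x mod p = 0" "y < x div p"
    | "x mod p > 0" "x mod p + m mod p < p" | "x mod p + m mod p \<ge> p"
    using y(1) by linarith
  then show ?thesis
  proof cases
    case 1
    then show ?thesis
      using nc[of 0] m0 assms(4) xeq by (intro exI[of _ x]) auto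
  next
    case 2
    \<comment> \<open>The loss in the higher digits leaves space for the lowest digit 1, which
      already gives strictness.\<close>
    then have "p * Suc y \<le> p * (x div p)" by (intro mult_le_mono2) auto
    then have "p * y + p \<le> p * (x div p)" by simp
    then have "p * y + 1 \<le> x" "x < 2 * (p * y + 1)"
      unfolding distrib_left using py xeq 2(1) p3 by linarith+
    then show ?thesis
      using nc[of 1] m0 p3 by (intro exI[of _ "p * y + 1"]) auto
  next
    case 3
    then have "p * y + x mod p \<le> x" "x < 2 * (p * y + x mod p)"
      unfolding distrib_left using py xeq by linarith+
    then show ?thesis
      using nc[OF 3(2)] by (intro exI[of _ "p * y + x mod p"]) auto
  next
    case 4
    \<comment> \<open>The digit of \<open>x\<close> does not fit, so the room is filled completely.
      As \<open>2 * g\<close> is at least \<open>p - 1\<close>, strictness can fail only if that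
      digit is \<open>p - 1\<close>, that is, if \<open>p\<close> divides
      \<open>x + 1\<close>.\<close>
    define g where "g = p - 1 - m mod p"
    have g: "g + m mod p < p" "g \<le> x mod p" "p - 1 \<le> 2 * g"
      using m0 4 p3 by (auto simp: g_def)
    have "p dvd x + 1" if "x mod p = p - 1"
    proof -
      have "x + 1 = p * Suc (x div p)" using that xeq p3 by simp
      then show ?thesis by (metis dvd_triv_left)
    qed
    moreover have "x mod p < p - 1 \<Longrightarrow> x < 2 * (p * y + g)"
      unfolding distrib_left using g(3) py xeq by linarith
    ultimately have "x < 2 * (p * y + g) \<or> p dvd x + 1" using xm by linarith
    moreover have "p * y + g \<le> x" "x \<le> 2 * (p * y + g)"
      unfolding distrib_left using g py xeq xm by linarith+
    ultimately show ?thesis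
      using nc[OF g(1)] by blast
  qed
qed

lemma digit_of_expansion:
  fixes p :: nat and e :: "nat \<Rightarrow> nat"
  assumes "\<And>j. j \<le> n \<Longrightarrow> e j < p" "r \<le> n"
  shows "(\<Sum>j=0..n. e j * p ^ j) div p ^ r mod p = e r"
  using assms
proof (induction r arbitrary: e n)
  case 0
  have "(\<Sum>j=0..n. e j * p ^ j) = e 0 + p * (\<Sum>j\<in>{Suc 0..n}. e j * p ^ (j - 1))"
    unfolding sum.atLeast_Suc_atMost[OF le0]
    by (auto simp: sum_distrib_left power_eq_if intro!: sum.cong)
  then show ?case using 0 by simp
next
  case (Suc r)
  then obtain n' where n: "n = Suc n'" by (cases n) auto
  have "(\<Sum>j=0..n. e j * p ^ j) = e 0 + p * (\<Sum>j=0..n'. e (Suc j) * p ^ j)"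
    unfolding n sum.atLeast_Suc_atMost[OF le0] sum.shift_bounds_cl_Suc_ivl
    by (simp add: sum_distrib_left algebra_simps)
  moreover have "e 0 < p" using Suc.prems by auto
  ultimately have "(\<Sum>j=0..n. e j * p ^ j) div p = (\<Sum>j=0..n'. e (Suc j) * p ^ j)"
    by simp
  then show ?case
    using Suc.IH[of n' "\<lambda>j. e (Suc j)"] Suc.prems n by (simp add: div_mult2_eq)
qed

section \<open>The polynomial method\<close>

text \<open>These are the weights of the divided difference over \<open>A\<close>. To add a point
  \<open>b\<close>, the old weights are divided by \<open>a - b\<close> and \<open>b\<close>
  receives the weight that makes the total zero; the new moments then satisfy
  \<open>T (Suc j) = b * T j\<close> plus the old moment of order \<open>j\<close>.\<close>

lemma exists_vandermonde_weights:
  fixes A :: "'a :: field set"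
  assumes "finite A" "card A = Suc k"
  shows "\<exists>c. (\<forall>j<k. (\<Sum>a\<in>A. c a * a ^ j) = 0) \<and> (\<Sum>a\<in>A. c a * a ^ k) = 1"
  using assms
proof (induction k arbitrary: A)
  case 0
  then obtain a where "A = {a}" by (auto simp: card_1_singleton_iff)
  then show ?case by (intro exI[of _ "\<lambda>_. 1"]) auto
next
  case (Suc k)
  then obtain b B where A: "A = insert b B" "b \<notin> B" "card B = Suc k" "finite B"
    by (metis card_Suc_eq finite_insert)
  from Suc.IH[OF A(4,3)] obtain c where c: "\<And>j. j < k \<Longrightarrow> (\<Sum>a\<in>B. c a * a ^ j) = 0"
    "(\<Sum>a\<in>B. c a * a ^ k) = 1" by blast
  define c' where "c' a = (if a = b then - (\<Sum>a\<in>B. c a / (a - b)) else c a / (a - b))" for a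
  define T where "T j = (\<Sum>a\<in>A. c' a * a ^ j)" for j
  have T0: "T 0 = 0"
  proof -
    have "(\<Sum>a\<in>B. c' a) = (\<Sum>a\<in>B. c a / (a - b))"
      using A(2) by (intro sum.cong) (auto simp: c'_def)
    then show ?thesis using A by (simp add: T_def c'_def)
  qed
  have step: "T (Suc j) = b * T j + (\<Sum>a\<in>B. c a * a ^ j)" for j
  proof -
    have "T (Suc j) - b * T j = (\<Sum>a\<in>A. c' a * a ^ j * (a - b))"
      by (simp add: T_def sum_distrib_left sum_subtractf[symmetric] algebra_simps)
    also have "\<dots> = (\<Sum>a\<in>B. c' a * a ^ j * (a - b))"
      using A by simp
    also have "\<dots> = (\<Sum>a\<in>B. c a * a ^ j)"
      using A(2) by (intro sum.cong) (auto simp: c'_def field_simps)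
    finally show ?thesis by (simp add: algebra_simps)
  qed
  have T_zero: "T j = 0" if "j \<le> k" for j
    using that by (induction j) (auto simp: T0 step c)
  then have "T (Suc k) = 1" by (simp add: step c)
  then show ?case
    using T_zero by (intro exI[of _ c']) (auto simp: T_def less_Suc_eq_le)
qed

text \<open>In the binomial expansion all moments of order below \<open>k\<close> vanish, so a
  translation leaves the moments up to order \<open>k\<close> unchanged.\<close>

lemma weights_translate:
  fixes A :: "'a :: field set"
  assumes "\<And>j. j < k \<Longrightarrow> (\<Sum>a\<in>A. c a * a ^ j) = 0" "(\<Sum>a\<in>A. c a * a ^ k) = 1" "j \<le> k"
  shows "(\<Sum>a\<in>A. c a * (a + b) ^ j) = (if j = k then 1 else 0)"
proof -
  have "(\<Sum>a\<in>A. c a * (a + b) ^ j) =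
      (\<Sum>a\<in>A. \<Sum>i\<le>j. of_nat (j choose i) * b ^ (j - i) * (c a * a ^ i))"
    by (simp add: binomial_ring sum_distrib_left algebra_simps)
  also have "\<dots> = (\<Sum>i\<le>j. of_nat (j choose i) * b ^ (j - i) * (\<Sum>a\<in>A. c a * a ^ i))"
    by (subst sum.swap) (simp add: sum_distrib_left)
  also have "\<dots> = (\<Sum>i\<le>j. if i = k then 1 else 0)"
    using assms by (intro sum.cong) (auto simp: nat_less_le)
  also have "\<dots> = (if j = k then 1 else 0)"
    using assms(3) by auto
  finally show ?thesis .
qed

lemma pcompose_power:
  fixes P Q :: "'a :: comm_semiring_1 poly"
  shows "pcompose (P ^ n) Q = pcompose P Q ^ n"
  by (induction n) (simp_all add: pcompose_1 pcompose_mult)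

text \<open>Here \<open>A\<close> carries the weights and \<open>B\<close> is the set of high-order
  zeros; counting zeros of \<open>F\<close> with multiplicity against its degree gives the
  bound.\<close>

lemma card_mult_le_of_sums_roots_of_unity:
  fixes A B :: "'a :: field set"
  assumes "finite A" "card A = Suc y" "finite B" "m > 0"
    and roots: "\<And>a b. a \<in> A \<Longrightarrow> b \<in> B \<Longrightarrow> (a + b) ^ m = 1"
    and nz: "of_nat (y + m choose m) \<noteq> (0 :: 'a)"
  shows "card B * Suc y \<le> m"
proof -
  obtain c where c: "\<And>j. j < y \<Longrightarrow> (\<Sum>a\<in>A. c a * a ^ j) = 0" "(\<Sum>a\<in>A. c a * a ^ y) = 1"
    using exists_vandermonde_weights[OF assms(1,2)] by blast
  define F where "F = (\<Sum>a\<in>A. smult (c a) ([:a, 1:] ^ (y + m))) - 1"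
  have coeff_sum_pow: "coeff (\<Sum>a\<in>A. smult (c a) ([:a + b, 1:] ^ (y + m))) i =
      of_nat (y + m choose i) * (\<Sum>a\<in>A. c a * (a + b) ^ (y + m - i))" if "i \<le> y + m" for b i
    using that by (simp add: coeff_sum coeff_linear_poly_power sum_distrib_left mult_ac)
  have "coeff F m = of_nat (y + m choose m)"
    using coeff_sum_pow[of m 0] c assms(4) by (simp add: F_def coeff_1)
  then have F0: "F \<noteq> 0" using nz by auto
  have deg: "degree F \<le> m"
  proof (rule degree_le, intro allI impI)
    fix i assume i: "i > m"
    show "coeff F i = 0"
    proof (cases "i \<le> y + m")
      case True
      \<comment> \<open>Coefficients beyond \<open>m\<close> are multiples of moments of order below
        \<open>y\<close>, hence zero.\<close>
      then have "y + m - i < y" using i by simp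
      then show ?thesis using coeff_sum_pow[OF True, of 0] c i by (simp add: F_def coeff_1)
    next
      case False
      have "coeff ([:a, 1:] ^ (y + m)) i = 0" for a :: 'a
        using False by (intro coeff_eq_0) (simp add: degree_linear_power)
      then show ?thesis using i by (simp add: F_def coeff_1 coeff_sum)
    qed
  qed
  have ord: "Suc y \<le> order b F" if b: "b \<in> B" for b
  proof -
    \<comment> \<open>Shifting \<open>b\<close> to the origin turns the order of vanishing into the
      vanishing of low coefficients.\<close>
    define G where "G = pcompose F [:b, 1:]"
    have G: "G = (\<Sum>a\<in>A. smult (c a) ([:a + b, 1:] ^ (y + m))) - 1"
      by (simp add: G_def F_def pcompose_diff pcompose_sum pcompose_smult pcompose_power
          pcompose_pCons pcompose_1 add.commute)
    have "coeff G i = 0" if i: "i < Suc y" for i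
    proof -
      have "(\<Sum>a\<in>A. c a * (a + b) ^ (y + m - i)) = (\<Sum>a\<in>A. c a * (a + b) ^ (y - i))"
      proof (intro sum.cong refl)
        fix a assume a: "a \<in> A"
        \<comment> \<open>For \<open>i \<le> y\<close> a full factor \<open>(a + b) ^ m = 1\<close>
          splits off, leaving a translated moment of order \<open>y - i\<close>. It is zero unless
          \<open>i = 0\<close>, where its value 1 cancels against the constant subtracted in
          \<open>F\<close>.\<close>
        have "y + m - i = (y - i) + m" using i by simp
        then show "c a * (a + b) ^ (y + m - i) = c a * (a + b) ^ (y - i)"
          using roots[OF a b] by (simp only: power_add) simp
      qed
      also have "\<dots> = (if i = 0 then 1 else 0)"
        using weights_translate[OF c, of "y - i" b] i by auto
      finally show ?thesis
        using coeff_sum_pow[of i b] i by (simp add: G coeff_1)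
    qed
    then have "monom 1 (Suc y) dvd G" by (simp add: monom_1_dvd_iff')
    then obtain H where "G = monom 1 (Suc y) * H" by (elim dvdE)
    then have "pcompose G [:- b, 1:] = [:- b, 1:] ^ Suc y * pcompose H [:- b, 1:]"
      by (simp only: pcompose_mult) (simp add: monom_altdef pcompose_power pcompose_pCons)
    moreover have "pcompose G [:- b, 1:] = F"
      by (simp add: G_def pcompose_assoc[symmetric] pcompose_pCons)
    ultimately have "[:- b, 1:] ^ Suc y dvd F" by (metis dvd_triv_left)
    then show ?thesis using F0 by (simp add: order_divides del: power_Suc)
  qed
  have fin: "finite {x. poly F x = 0}" using F0 by (rule poly_roots_finite)
  have "B \<subseteq> {x. poly F x = 0}"
    using ord F0 by (force simp: order_root)
  have "card B * Suc y = (\<Sum>b\<in>B. Suc y)" by simp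
  also have "\<dots> \<le> (\<Sum>b\<in>B. order b F)" using ord by (intro sum_mono)
  also have "\<dots> \<le> (\<Sum>b | poly F b = 0. order b F)"
    using \<open>B \<subseteq> _\<close> fin by (intro sum_mono2) auto
  also have "\<dots> \<le> degree F" using F0 by (rule sum_order_le_degree)
  finally show ?thesis using deg by linarith
qed

section \<open>Sumset size and finite field facts\<close>

lemma card_sumset_self_le:
  fixes A :: "'a :: ab_semigroup_add set"
  assumes "finite A"
  shows "2 * card (A + A) \<le> card A * (card A + 1)"
  using assms
proof (induction A)
  case empty
  then show ?case by (simp add: set_plus_def)
next
  case (insert x A)
  have "insert x A + insert x A \<subseteq> (A + A) \<union> (+) x ` insert x A"
    by (auto simp: set_plus_def add.commute)
  moreover have "finite (A + A)" using insert by (simp add: finite_set_plus)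
  ultimately have "card (insert x A + insert x A) \<le> card (A + A) + card ((+) x ` insert x A)"
    using insert by (meson card_Un_le card_mono finite_UnI finite_imageI finite_insert order_trans)
  also have "card ((+) x ` insert x A) \<le> card (insert x A)"
    using insert by (intro card_image_le) auto
  finally show ?case using insert by (simp add: algebra_simps)
qed

lemma finite_field_power_card_minus_one:
  fixes x :: "'a :: {field, finite}"
  assumes "x \<noteq> 0"
  shows "x ^ (card (UNIV :: 'a set) - 1) = 1"
proof -
  have "x ^ (card (UNIV :: 'a set) - 1) * \<Prod>(UNIV - {0}) = (\<Prod>y\<in>UNIV-{0}. x * y)"
    by (simp add: prod.distrib)
  also have "\<dots> = \<Prod>(UNIV - {0})"
    by (rule prod.reindex_bij_witness[of _ "\<lambda>y. y / x" "\<lambda>y. x * y"]) (use assms in auto)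
  finally show ?thesis by simp
qed

text \<open>Translation by 1 permutes the field, so summing over all elements shows that
  \<open>p ^ n\<close> is zero in it; the characteristic is therefore \<open>p\<close>.\<close>

lemma of_nat_eq_0_iff_prime_dvd:
  fixes p :: nat
  assumes "prime p" "card (UNIV :: 'a :: {field, finite} set) = p ^ n"
  shows "of_nat k = (0 :: 'a) \<longleftrightarrow> p dvd k"
proof -
  have "(\<Sum>x\<in>UNIV. x + 1) = (\<Sum>x\<in>UNIV. x :: 'a)"
    by (rule sum.reindex_bij_witness[of _ "\<lambda>x. x - 1" "\<lambda>x. x + 1"]) auto
  then have "of_nat (p ^ n) = (0 :: 'a)"
    using assms(2) by (simp add: sum.distrib)
  then have dvd: "CHAR('a) dvd p ^ n"
    by (simp only: of_nat_eq_0_iff_char_dvd)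
  have "CHAR('a) > 0"
    by (intro finite_imp_CHAR_pos) simp
  then have "prime CHAR('a)"
    by (rule prime_CHAR_semidom)
  then have "CHAR('a) = p"
    using dvd assms(1) by (metis prime_dvd_power primes_dvd_imp_eq)
  then show ?thesis by (simp add: of_nat_eq_0_iff_char_dvd)
qed

text \<open>Every fibre of the power map consists of roots of a polynomial of degree
  \<open>d\<close>.\<close>

lemma card_nonzero_le_card_powers:
  fixes d :: nat
  assumes "d > 0"
  shows "card (UNIV :: 'a :: {field, finite} set) - 1 \<le> d * card {x ^ d | x :: 'a. x \<noteq> 0}"
    (is "_ \<le> d * card ?S")
proof -
  have fib: "card {x :: 'a. x ^ d = s} \<le> d" for s
  proof -
    define P where "P = monom 1 d - [:s:]"
    have "degree P \<le> d"
      unfolding P_def by (intro degree_diff_le) (auto simp: degree_monom_le)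
    moreover have "coeff P d = 1"
      using assms by (cases d) (auto simp: P_def)
    then have "P \<noteq> 0" by auto
    ultimately have "card {x. poly P x = 0} \<le> d"
      using card_poly_roots_bound[of P] by linarith
    then show ?thesis by (simp add: P_def poly_monom)
  qed
  have "card (UNIV - {0 :: 'a}) \<le> card (\<Union>s\<in>?S. {x :: 'a. x ^ d = s})"
    by (intro card_mono) auto
  also have "\<dots> \<le> (\<Sum>s\<in>?S. card {x :: 'a. x ^ d = s})" by (intro card_UN_le) auto
  also have "\<dots> \<le> (\<Sum>s\<in>?S. d)" using fib by (intro sum_mono)
  finally show ?thesis by (simp add: card_Diff_singleton mult.commute)
qed

section \<open>Arithmetic contradictions from the digit conditions\<close>

text \<open>Only the numerical traces of \<open>A + A = S\<close> are kept, with \<open>N\<close>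
  the size of \<open>A\<close>: \<open>m_le\<close> counts the sums, and \<open>no_carry\<close> is
  the outcome of the polynomial method.\<close>

locale sumset_bounds =
  fixes p n d m N :: nat
  assumes prime: "prime p" and odd: "odd p"
    and order_eq: "d * m + 1 = p ^ n" and d_ge: "2 \<le> d" and m_ge: "3 \<le> m"
    and m_le: "2 * m \<le> N * (N + 1)"
    and no_carry: "\<And>y. y < N \<Longrightarrow> \<not> p dvd (y + m choose m) \<Longrightarrow> N * (y + 1) \<le> m"
begin

lemma p_ge: "3 \<le> p"
  using prime odd prime_ge_2_nat[of p] by (cases "p = 2") auto

lemma N_ge: "2 \<le> N"
proof (rule ccontr)
  assume "\<not> 2 \<le> N"
  then have "N = 0 \<or> N = 1" by auto
  then show False using m_le m_ge by auto
qed

lemma n_pos: "n > 0"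
  using order_eq d_ge m_ge by (cases n) auto

lemma two_m_less: "2 * m < p ^ n"
  using order_eq mult_le_mono1[OF d_ge, of m] by linarith

lemma no_carry_le: "y < N \<Longrightarrow> \<not> p dvd (y + m choose m) \<Longrightarrow> 2 * y + 1 \<le> N"
proof -
  assume "y < N" "\<not> p dvd (y + m choose m)"
  then have "N * (2 * (y + 1)) \<le> N * (N + 1)"
    using no_carry[of y] m_le by (simp add: algebra_simps)
  then have "2 * (y + 1) \<le> N + 1"
    using N_ge by (subst (asm) mult_le_cancel1) auto
  then show ?thesis by simp
qed

text \<open>As \<open>m < p\<close>, every \<open>y \<le> p - 1 - m\<close> is free of carries.
  Either this covers \<open>N - 1\<close>, which is too large, or \<open>y = p - 1 - m\<close> gives
  \<open>N * (p - m) \<le> m\<close>, although \<open>p - m\<close> is at least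
  \<open>m / 2\<close>.\<close>

lemma not_three_m_le: "\<not> 3 * m \<le> 2 * p"
proof
  assume le: "3 * m \<le> 2 * p"
  then have "m < p" using p_ge by linarith
  then have nd: "\<not> p dvd (y + m choose m)" if "y + m < p" for y
    using not_prime_dvd_choose_single_digit[OF prime, of y m 0] that by simp
  show False
  proof (cases "N + m \<le> p")
    case True
    then show False
      using no_carry_le[of "N - 1"] nd[of "N - 1"] N_ge by auto
  next
    case False
    define y where "y = p - 1 - m"
    have y: "y + m < p" "y < N" "y + 1 = p - m" using False \<open>m < p\<close> by (auto simp: y_def)
    have "N * (p - m) \<le> m" using no_carry[OF y(2) nd[OF y(1)]] unfolding y(3) .
    moreover have "2 * (p - m) \<le> N * (p - m)" using N_ge by (rule mult_le_mono1)
    ultimately have *: "2 * (p - m) \<le> m" by linarith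
    show False
    \<comment> \<open>For \<open>N = 2\<close> the sum count forces \<open>m = 3\<close>, hence
      \<open>p \<le> 4\<close>, against \<open>9 \<le> 2 * p\<close>.\<close>
    proof (cases "N = 2")
      case True
      then show False using m_le m_ge \<open>N * (p - m) \<le> m\<close> le False by auto
    next
      case False
      then have "3 * (p - m) \<le> N * (p - m)" using N_ge by (intro mult_le_mono1) auto
      then show False using \<open>N * (p - m) \<le> m\<close> le p_ge \<open>m < p\<close> by linarith
    qed
  qed
qed

lemma not_all_low_digits_small:
  assumes "\<And>j. 2 * j < n \<Longrightarrow> 2 * (m div p ^ j mod p) < p"
  shows False
proof -
  define k where "k = (n + 1) div 2"
  have k: "k \<ge> 1" "2 * k \<ge> n" "\<And>j. j < k \<Longrightarrow> 2 * j < n"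
    using n_pos by (auto simp: k_def)
  have pk: "p ^ k \<ge> 3"
    using p_ge power_increasing[OF k(1), of p] by simp
  \<comment> \<open>The largest usable target: below \<open>N\<close>, and within the
    \<open>k\<close> digits under control.\<close>
  define x where "x = min (N - 1) (p ^ k - 1)"
  have x: "0 < x" "x < p ^ k" "x < N"
    using N_ge pk by (auto simp: x_def)
  obtain y where y: "y \<le> x" "x \<le> 2 * y" "x < 2 * y \<or> p dvd x + 1" "\<not> p dvd (y + m choose m)"
    using no_carry_half_strict[OF prime odd, of k m x] assms k(3) x(1,2) by blast
  have yN: "y < N" using y(1) x(3) by simp
  show False
  proof (cases "N \<le> p ^ k")
    case True
    then have xN: "x + 1 = N" using N_ge by (auto simp: x_def)
    then have "p dvd N" "N = 2 * y + 1"
      using no_carry_le[OF yN y(4)] y by auto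
    \<comment> \<open>In the equality case the upper and lower bounds for \<open>m\<close> coincide,
      so \<open>p\<close> divides \<open>m\<close>, which is impossible as \<open>d * m + 1\<close>
      is a power of \<open>p\<close>.\<close>
    then have "N * (N + 1) = 2 * (N * (y + 1))" by simp
    then have "m = N * (y + 1)"
      using m_le no_carry[OF yN y(4)] by linarith
    then have "p dvd m" using \<open>p dvd N\<close> by simp
    moreover have "p dvd d * m + 1"
      unfolding order_eq using n_pos by simp
    ultimately have "p dvd 1" by (metis dvd_add_right_iff dvd_mult)
    then show False using p_ge by simp
  next
    case False
    then have "x = p ^ k - 1" by (simp add: x_def)
    then have "p ^ k \<le> 2 * (y + 1)" using y(2) by simp
    then have "p ^ k * p ^ k \<le> N * (2 * (y + 1))"
      using False by (intro mult_le_mono) auto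
    also have "\<dots> \<le> 2 * m" using no_carry[OF yN y(4)] by simp
    also have "\<dots> < p ^ n" by (rule two_m_less)
    also have "\<dots> \<le> p ^ (k + k)" using k(2) p_ge by (intro power_increasing) auto
    finally show False by (simp add: power_add)
  qed
qed

text \<open>Compare \<open>N - 1\<close> with \<open>c p\<^sup>r\<close>, where \<open>c \<ge> 1\<close> is the quotient \<open>(N - 1) div p\<^sup>r\<close>:
  if \<open>c\<close> could be added to the digit of \<open>m\<close> without carry, more than half of \<open>A\<close> would be usable.\<close>
lemma top_digit_bound:
  assumes "p ^ r < N" and t: "t + m div p ^ r mod p = p - 1"
  shows "N * (t * p ^ r + 1) \<le> m" "2 * (t * p ^ r) < N"
proof -
  define c where "c = (N - 1) div p ^ r"
  have R0: "p ^ r > 0" using p_ge by simp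
  have nd: "\<not> p dvd (u * p ^ r + m choose m)" if "u \<le> t" for u
    using not_prime_dvd_choose_single_digit[OF prime, of u m r] that t p_ge by simp
  have "c \<ge> 1"
    using assms(1) R0 by (simp add: c_def div_greater_zero_iff Suc_le_eq)
  have c1: "c * p ^ r \<le> N - 1" by (simp add: c_def)
  have c2: "N - 1 < c * p ^ r + p ^ r"
    unfolding c_def using R0 by (metis add.commute dividend_less_div_times)
  have "p ^ r \<le> c * p ^ r" using \<open>c \<ge> 1\<close> by simp
  have "t < c"
  proof (rule ccontr)
    assume "\<not> t < c"
    then have "2 * (c * p ^ r) + 1 \<le> N"
      using no_carry_le[of "c * p ^ r"] nd[of c] c1 N_ge by simp
    then show False using c2 \<open>p ^ r \<le> c * p ^ r\<close> by linarith
  qed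
  then have "t * p ^ r \<le> c * p ^ r" by simp
  then have "t * p ^ r < N" using c1 N_ge by linarith
  then show "N * (t * p ^ r + 1) \<le> m" "2 * (t * p ^ r) < N"
    using no_carry[of "t * p ^ r"] no_carry_le[of "t * p ^ r"] nd[of t] by auto
qed

text \<open>The bound on \<open>d\<close> makes \<open>m\<close> so large that \<open>N\<close>
  exceeds \<open>R = p ^ r\<close>. Then \<open>t * R\<close> is a carry-free value, and
  \<open>p \<le> 4 * t ^ 2\<close> makes its two consequences \<open>2 * (t * R) < N\<close> and
  \<open>N * (t * R + 1) \<le> m\<close> incompatible.\<close>

lemma not_middle_digit_odd:
  assumes n: "n = 2 * r + 1" "r \<ge> 1" and d: "d \<le> 2 * p - 2"
    and t: "t + m div p ^ r mod p = p - 1" "p \<le> 4 * t ^ 2"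
  shows False
proof -
  define R where "R = p ^ r"
  have Rp: "R \<ge> p"
    using power_increasing[OF n(2), of p] p_ge by (simp add: R_def)
  have pn: "p ^ n = p * (R * R)"
    by (simp add: n(1) R_def power_add power_mult power2_eq_square mult.commute power_mult_distrib)
  obtain s where s: "p = Suc s" using p_ge by (cases p) auto
  have "R < N"
  proof (rule ccontr)
    assume "\<not> R < N"
    then have "N * (N + 1) \<le> R * (R + 1)" by (intro mult_le_mono) auto
    then have "2 * m \<le> R * (R + 1)" using m_le by linarith
    then have "s * (2 * m) \<le> s * (R * (R + 1))" by (rule mult_le_mono2)
    moreover have "d * m \<le> (2 * s) * m" using d s by (intro mult_le_mono1) auto
    moreover have "2 * s * m = s * (2 * m)" by simp
    ultimately have "p * (R * R) \<le> s * (R * (R + 1)) + 1"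
      using order_eq pn by linarith
    then have "R * R \<le> s * R + 1" by (simp add: s algebra_simps)
    moreover have "p * R \<le> R * R" using Rp by (rule mult_le_mono1)
    ultimately show False using Rp p_ge by (simp add: s)
  qed
  note top = top_digit_bound[OF \<open>R < N\<close>[unfolded R_def] t(1), folded R_def]
  have t0: "t > 0" using t(2) p_ge by (cases t) auto
  have "N * (2 * t) * R \<le> 2 * (N * (t * R + 1))" by (simp add: algebra_simps)
  also have "\<dots> < p * R * R" using top(1) two_m_less pn by (simp add: mult.assoc)
  finally have "N * (2 * t) < p * R" by simp
  also have "\<dots> \<le> 4 * t ^ 2 * R" using t(2) by (rule mult_le_mono1)
  finally have "N * (2 * t) < (2 * (t * R)) * (2 * t)" by (simp add: power2_eq_square algebra_simps)
  then have "N < 2 * (t * R)" using mult_less_cancel2 by blast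
  then show False using top(2) by simp
qed

text \<open>With \<open>R = p ^ (r - 1)\<close>, the bound on \<open>d\<close> gives
  \<open>R * R \<le> 2 * m\<close>. If \<open>N \<le> R\<close>, then \<open>2 * m\<close> lies
  within \<open>R\<close> of \<open>R * R\<close>, which pins the digit to a residue that the
  hypothesis excludes. Otherwise \<open>t * R\<close> is a carry-free value with
  \<open>p * R \<le> 2 * (t * R)\<close>, too large for \<open>2 * m < p ^ n\<close>.\<close>

lemma not_middle_digit_even:
  assumes n: "n = 2 * r" and d: "d \<le> 2 * p\<^sup>2" and digit: "2 * (m div p ^ (r - 1) mod p) + 3 \<le> p"
  shows False
proof (cases "r = 1")
  case True
  show False
  proof (rule not_all_low_digits_small)
    fix j assume "2 * j < n"
    then have "j = r - 1" using n True by simp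
    then show "2 * (m div p ^ j mod p) < p" using digit by simp
  qed
next
  case False
  then have r: "r \<ge> 2" using n n_pos by simp
  define R where "R = p ^ (r - 1)"
  define D where "D = m div R mod p"
  have pr: "p ^ r = p * R" unfolding R_def using r by (cases r) auto
  then have pn: "p ^ n = p\<^sup>2 * (R * R)"
    by (simp add: n mult.commute[of 2] power_mult) (simp add: power2_eq_square algebra_simps)
  have p2: "p\<^sup>2 \<ge> 2" using mult_le_mono[OF p_ge p_ge] by (simp add: power2_eq_square)
  have "d * m \<le> 2 * p\<^sup>2 * m" using d by (rule mult_le_mono1)
  moreover have "2 * p\<^sup>2 * m = p\<^sup>2 * (2 * m)" by simp
  ultimately have "p\<^sup>2 * (R * R) \<le> p\<^sup>2 * (2 * m) + 1" using order_eq pn by linarith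
  then have "p\<^sup>2 * (R * R) < p\<^sup>2 * (2 * m + 1)" unfolding distrib_left using p2 by linarith
  then have m_lower: "R * R \<le> 2 * m" by (subst (asm) mult_less_cancel1) simp
  have "R < N"
  proof (rule ccontr)
    assume "\<not> R < N"
    then have "N * (N + 1) \<le> R * (R + 1)" by (intro mult_le_mono) auto
    then have m_upper: "2 * m \<le> R * R + R" using m_le by simp
    \<comment> \<open>With \<open>R = 2 * h + 1\<close> the quotient \<open>m div R\<close> is
      \<open>h\<close> or \<open>h + 1\<close>. Since \<open>p\<close> divides \<open>R\<close>, the
      digit \<open>D\<close> satisfies \<open>2 * D \<equiv> -1\<close> or
      \<open>2 * D \<equiv> 1\<close> modulo \<open>p\<close>, and both contradict
      \<open>2 * D + 3 \<le> p\<close>.\<close>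
    have "odd R" using odd by (simp add: R_def)
    then obtain h where h: "R = 2 * h + 1" by (elim oddE)
    have "p dvd R" using r by (simp add: R_def)
    have "R * h * 2 + R = R * R" by (simp add: h algebra_simps)
    then have "R * h \<le> m" "m \<le> R * h + R" using m_lower m_upper by linarith+
    then consider "m div R = h" | "m div R = h + 1"
    proof (cases "m = R * h + R")
      case True
      then have "m = R * (h + 1)" by simp
      then show ?thesis using that(2) \<open>odd R\<close> by (metis even_zero nonzero_mult_div_cancel_left)
    next
      case False
      then have "m div R = h"
        using \<open>R * h \<le> m\<close> \<open>m \<le> R * h + R\<close> by (intro div_nat_eqI) (simp_all add: mult.commute)
      then show ?thesis by (rule that(1))
    qed
    then show False
    proof cases
      case 1
      have "D = h mod p" using 1 by (simp add: D_def)
      then have "p * (h div p) + D = h" by simp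
      then have "p * (2 * (h div p)) + (2 * D + 1) = R" using h by simp
      then have "p dvd 2 * D + 1" using \<open>p dvd R\<close> by (metis dvd_add_right_iff dvd_triv_left)
      then show False using digit by (auto dest!: dvd_imp_le simp: D_def R_def)
    next
      case 2
      have "D = (h + 1) mod p" using 2 by (simp add: D_def)
      then have "p * ((h + 1) div p) + D = h + 1" by simp
      then have "p * (2 * ((h + 1) div p)) + 2 * D = R + 1" using h by simp
      then have "2 * D mod p = (R + 1) mod p" by (metis mod_mult_self4)
      also have "\<dots> = (R mod p + 1) mod p" by (simp only: mod_add_left_eq)
      also have "\<dots> = 1" using \<open>p dvd R\<close> p_ge by simp
      finally have "2 * D = 1" using digit by (simp add: D_def R_def)
      then show False by presburger
    qed
  qed
  define t where "t = p - 1 - D"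
  have t: "t + D = p - 1" "p + 1 \<le> 2 * t" using digit by (auto simp: t_def D_def R_def)
  note top = top_digit_bound[of "r - 1" t, folded R_def, folded D_def, OF \<open>R < N\<close> t(1)]
  have pR: "p * R \<le> 2 * (t * R)" using mult_le_mono1[of p "2 * t" R] t(2) by (simp add: mult.assoc)
  have "p * R * (p * R) \<le> N * (2 * (t * R))"
    by (rule mult_le_mono) (use pR top(2) in linarith)+
  also have "\<dots> \<le> 2 * m" using top(1) by simp
  also have "\<dots> < p ^ n" by (rule two_m_less)
  finally show False by (simp add: pn power2_eq_square algebra_simps)
qed

end

section \<open>From a sumset decomposition of the \<open>d\<close>-th powers to the arithmetic
  bounds\<close>

theorem theorem1p3:
  fixes p n q d :: nat
    and e :: "nat \<Rightarrow> nat"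
    and S :: "'a :: {field, finite} set"
  assumes "prime p"
    and "q = p ^ n"
    and "card (UNIV :: 'a set) = q"
    and "d dvd q - 1"
    and "2 \<le> d" and "d < q - 1"
    and "S = {x ^ d | x :: 'a. x \<noteq> 0}"
    and "(q - 1) div d = (\<Sum>j=0..n. e j * p ^ j)"
    and "\<forall>j\<le>n. e j \<le> p - 1"
    and "real ((q - 1) div d) \<le> 2 * real p / 3
       \<or> (\<forall>j. real j < real n / 2 \<longrightarrow> real (e j) \<le> (real p - 1) / 2)
       \<or> (\<exists>r\<ge>1. n = 2 * r + 1 \<and> d \<le> 2 * p - 2
            \<and> real (e r) \<le> real p - 1 - real_of_int \<lceil>sqrt (real p)\<rceil> / 2)
       \<or> (\<exists>r. n = 2 * r \<and> d \<le> 2 * p ^ 2 \<and> real (e (r - 1)) \<le> (real p - 3) / 2)"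
  shows "\<not> (\<exists>A :: 'a set. A + A = S)"
proof
  assume "\<exists>A :: 'a set. A + A = S"
  then obtain A :: "'a set" where A: "A + A = S" ..
  define m where "m = (q - 1) div d"
  define N where "N = card A"
  have p2: "p \<ge> 2" using assms(1) by (rule prime_ge_2_nat)
  have dm: "d * m = q - 1" using assms(4) by (simp add: m_def)
  then have m2: "m \<ge> 2"
    using assms(5,6) by (cases m; cases "m - 1") auto
  have card_S: "m \<le> card S"
  proof -
    have "d * m \<le> d * card S"
      using card_nonzero_le_card_powers[of d, where 'a = 'a] assms(3,5,7) dm by simp
    then show ?thesis using assms(5) by simp
  qed
  have S_pow: "s ^ m = 1" if "s \<in> S" for s
    using that finite_field_power_card_minus_one[where 'a = 'a] assms(3,7) dm
    by (auto simp flip: power_mult)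
  then have sum_pow: "(a + b) ^ m = 1" if "a \<in> A" "b \<in> A" for a b
    using that A by (auto simp: set_plus_def)
  have char: "of_nat k = (0 :: 'a) \<longleftrightarrow> p dvd k" for k
    using of_nat_eq_0_iff_prime_dvd[OF assms(1)] assms(2,3) by blast
  have "A \<noteq> {}"
    using A card_S m2 by (auto simp: set_plus_def)
  then obtain a0 where a0: "a0 \<in> A" by auto
  have double: "a + a = of_nat 2 * a" for a :: 'a by simp
  \<comment> \<open>In characteristic 2 the sum \<open>a0 + a0\<close> would be 0, which is not a
    root of unity.\<close>
  have odd: "odd p"
  proof
    assume "even p"
    then have "p = 2" using assms(1) by (metis primes_dvd_imp_eq two_is_prime_nat)
    then have "a0 + a0 = 0" unfolding double using char[of 2] by simp
    then have "0 ^ m = (1 :: 'a)" using sum_pow[OF a0 a0] by metis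
    then show False using m2 by (simp add: power_0_left)
  qed
  have m_le: "2 * m \<le> N * (N + 1)"
    using card_sumset_self_le[of A] card_S A by (simp add: N_def)
  \<comment> \<open>If all sums square to 1, then \<open>2 * a\<close> and \<open>2 * b\<close>
    agree up to sign; the opposite sign would give the sum \<open>a + b = 0\<close>. So
    \<open>A\<close> has one element and too few sums.\<close>
  have "m \<noteq> 2"
  proof
    assume m: "m = 2"
    have two: "of_nat 2 \<noteq> (0 :: 'a)"
      using char[of 2] odd assms(1) by (metis primes_dvd_imp_eq two_is_prime_nat dvd_refl)
    have "a = b" if ab: "a \<in> A" "b \<in> A" for a b
    proof (rule ccontr)
      assume "a \<noteq> b"
      have "(a + a) ^ 2 = (b + b) ^ 2" using sum_pow ab m by metis
      then have "a + a = b + b \<or> a + a = - (b + b)" by (simp only: power2_eq_iff)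
      moreover have "a + a \<noteq> b + b" unfolding double using two \<open>a \<noteq> b\<close> by simp
      ultimately have "of_nat 2 * (a + b) = 0" by (simp add: algebra_simps)
      then have "a + b = 0" using two by (simp only: mult_eq_0_iff) blast
      then show False using sum_pow[OF ab] m by simp
    qed
    then have "A = {a0}" using a0 by auto
    then show False using m_le m by (simp add: N_def)
  qed
  interpret sumset_bounds p n d m N
  proof
    show "N * (y + 1) \<le> m" if y: "y < N" "\<not> p dvd (y + m choose m)" for y
    proof -
      \<comment> \<open>The weights live on \<open>B\<close>, while all of \<open>A\<close> serves
        as the set of zeros.\<close>
      obtain B where B: "B \<subseteq> A" "card B = Suc y"
        using y(1) by (metis N_def Suc_leI obtain_subset_with_card_n)
      then show ?thesis
        using card_mult_le_of_sums_roots_of_unity[of B y A m] sum_pow char y(2) m2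
        by (auto simp: N_def)
    qed
    show "d * m + 1 = p ^ n" using dm assms(2,6) by simp
  qed (use assms(1,5) odd m2 \<open>m \<noteq> 2\<close> m_le in auto)
  have digit: "m div p ^ j mod p = e j" if "j \<le> n" for j
    unfolding m_def assms(8) using that assms(9) p2
    by (intro digit_of_expansion) (auto simp: le_eq_less_or_eq less_diff_conv2)
  from assms(10)[folded m_def] consider
      "3 * m \<le> 2 * p"
    | "\<forall>j. real j < real n / 2 \<longrightarrow> real (e j) \<le> (real p - 1) / 2"
    | r where "r \<ge> 1" "n = 2 * r + 1" "d \<le> 2 * p - 2"
        "real (e r) \<le> real p - 1 - real_of_int \<lceil>sqrt (real p)\<rceil> / 2"
    | r where "n = 2 * r" "d \<le> 2 * p ^ 2" "real (e (r - 1)) \<le> (real p - 3) / 2"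
    by (elim disjE exE conjE) auto
  then show False
  proof cases
    case 1
    then show False using not_three_m_le by simp
  next
    case 2
    show False
    proof (rule not_all_low_digits_small)
      fix j assume "2 * j < n"
      then have "real (e j) \<le> (real p - 1) / 2" using 2 by auto
      then show "2 * (m div p ^ j mod p) < p" using digit[of j] \<open>2 * j < n\<close> by simp
    qed
  next
    case (3 r)
    \<comment> \<open>The room above the middle digit; the ceiling condition says that
      \<open>2 * t\<close> is at least the square root of \<open>p\<close>.\<close>
    define t where "t = p - 1 - e r"
    have "e r \<le> p - 1" using assms(9) 3 by auto
    then have t: "t + e r = p - 1" "real t = real p - 1 - real (e r)"
      using p2 by (auto simp: t_def)
    have "sqrt (real p) \<le> 2 * real t" using t(2) 3(4) le_of_int_ceiling[of "sqrt (real p)"] by linarith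
    then have "(sqrt (real p)) ^ 2 \<le> (2 * real t) ^ 2" by (intro power_mono) auto
    then have "real p \<le> real (4 * t ^ 2)" by (simp add: power_mult_distrib)
    then have "p \<le> 4 * t ^ 2" by (simp only: of_nat_le_iff)
    then show False
      using not_middle_digit_odd[OF 3(2,1,3), of t] t(1) digit[of r] 3(2) by simp
  next
    case (4 r)
    then have "real (2 * e (r - 1) + 3) \<le> real p" by simp
    then have "2 * e (r - 1) + 3 \<le> p" by (simp only: of_nat_le_iff)
    then show False
      using not_middle_digit_even[OF 4(1,2)] digit[of "r - 1"] 4(1) by simp
  qed
qed

end
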